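(* The modified partial Petrial polynomial of any simple signed graph $S$ is $4$-invariant; that is, for every simple signed graph $S$ and every pair of distinct vertices $a,b\in V(S)$, $${}^{M\partial}\varepsilon^{\times}_{S}(z)-{}^{M\partial}\varepsilon^{\times}_{\widetilde{S}_{a,b}}(z)+{}^{M\partial}\varepsilon^{\times}_{\widetilde{S}^{\prime}_{a,b}}(z)-{}^{M\partial}\varepsilon^{\times}_{S^{\prime}_{a,b}}(z)=0.$$
   Context: All graphs are finite and undirected. A simple signed graph is a simple graph each of whose vertices is labeled with a sign $+$ or $-$. For a simple signed graph $S$, the adjacency matrix $\operatorname{adj}(S)$ is the matrix over $\mathbb{GF}(2)$ obtained from the adjacency matrix of the underlying (unsigned) simple graph by assigning $1$ to the diagonal entries corresponding to the vertices with sign $-$ (the other diagonal entries are $0$). For $W\subseteq V(S)$, $\mathbb{D}_W$ is the diagonal matrix indexed by $V(S)$ whose $(v,v)$ entry is $1$ if $v\in W$ and $0$ otherwise. Let $X$ be the set of all vertices of $S$ with sign $-$. The modified partial Petrial polynomial of $S$ is $${}^{M\partial}\varepsilon^{\times}_{S}(z)=\sum_{A\subseteq V(S)}(-1)^{|A|}z^{\operatorname{rank}(\operatorname{adj}(S)+\mathbb{D}_{X\Delta A})},$$ where $\Delta$ is the symmetric difference and the rank is taken over $\mathbb{GF}(2)$. (For each of the other graphs below, the polynomial is defined by the same formula applied to that graph.) Let $a,b$ be distinct vertices of $S$. - $S^{\prime}_{a,b}$ is obtained from $S$ by removing the edge $ab$ if it exists, or by adding it if it does not exist. - $\widetilde{S}_{a,b}$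 is obtained from $S$ by first changing the adjacency between $a$ and every vertex $c\neq a$ of $N(b)$, the set of all neighbours of $b$ in $S$, and then changing the sign of $a$ if the sign of $b$ is $-$; otherwise the sign of $a$ is unchanged. - $\widetilde{S}^{\prime}_{a,b}$ (also written $\widetilde{S^{\prime}}_{a,b}$) is the graph obtained by composing these two operations, $(\widetilde{S}_{a,b})^{\prime}_{a,b}=\widetilde{(S^{\prime}_{a,b})}_{a,b}$. A graph invariant $g$ is called $4$-invariant if $g(S)-g(\widetilde{S}_{a,b})+g(\widetilde{S}^{\prime}_{a,b})-g(S^{\prime}_{a,b})=0$ for each graph $S$ and any pair $a,b$ of its vertices. *)

theory Defs
  imports
    "HOL-Analysis.Analysis"
    "HOL-Library.Z2"
    "HOL-Library.Function_Algebras"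
    "HOL-Computational_Algebra.Polynomial"
begin

section \<open>Simple signed graphs\<close>

text \<open>An edge is a two-element set of vertices; \<open>neg S\<close> is the set of vertices with sign \<open>-\<close>.\<close>

record 'v signed_graph =
  verts :: "'v set"
  edges :: "'v set set"
  neg :: "'v set"

definition simple_signed_graph :: "'v signed_graph \<Rightarrow> bool" where
  "simple_signed_graph S \<longleftrightarrow>
     finite (verts S) \<and>
     (\<forall>e\<in>edges S. e \<subseteq> verts S \<and> card e = 2) \<and>
     neg S \<subseteq> verts S"

definition neighbours :: "'v signed_graph \<Rightarrow> 'v \<Rightarrow> 'v set" where
  "neighbours S b = {c. {b, c} \<in> edges S}"

definition signed_graph_iso :: "'v signed_graph \<Rightarrow> 'v signed_graph \<Rightarrow> bool" where
  "signed_graph_iso S T \<longleftrightarrow>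
     (\<exists>f. bij_betw f (verts S) (verts T) \<and>
          (\<forall>u\<in>verts S. \<forall>v\<in>verts S. {u, v} \<in> edges S \<longleftrightarrow> {f u, f v} \<in> edges T) \<and>
          (\<forall>v\<in>verts S. v \<in> neg S \<longleftrightarrow> f v \<in> neg T))"


section \<open>Matrices over GF(2) indexed by a finite vertex set\<close>

text \<open>
  A matrix indexed by \<open>V\<close> is a function \<open>'v \<Rightarrow> 'v \<Rightarrow> bit\<close>, of which only the entries
  in \<open>V \<times> V\<close> are used. Its rank is the dimension of its row space, as for the
  \<open>rank\<close> of HOL-Analysis; the row of \<open>u\<close> is extended by \<open>0\<close> outside \<open>V\<close>, so that
  the row space lives in the \<open>GF(2)\<close>-vector space \<open>'v \<Rightarrow> bit\<close>. The lemma
  \<open>rank_on_eq_rank\<close> below relates the two notions.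
\<close>

definition fun_scale :: "bit \<Rightarrow> ('v \<Rightarrow> bit) \<Rightarrow> 'v \<Rightarrow> bit" where
  "fun_scale c x = (\<lambda>v. c * x v)"

global_interpretation gf2: vector_space "fun_scale :: bit \<Rightarrow> ('v \<Rightarrow> bit) \<Rightarrow> 'v \<Rightarrow> bit"
  by unfold_locales (auto simp: fun_scale_def fun_eq_iff algebra_simps)

definition row_on :: "'v set \<Rightarrow> ('v \<Rightarrow> 'v \<Rightarrow> bit) \<Rightarrow> 'v \<Rightarrow> 'v \<Rightarrow> bit" where
  "row_on V M u = (\<lambda>v. if v \<in> V then M u v else 0)"

definition rank_on :: "'v set \<Rightarrow> ('v \<Rightarrow> 'v \<Rightarrow> bit) \<Rightarrow> nat" where
  "rank_on V M = gf2.dim (row_on V M ` V)"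

lemma rank_on_eq_rank:
  fixes f :: "'n::finite \<Rightarrow> 'v"
  assumes f: "bij_betw f UNIV V"
  shows "rank_on V M = rank (\<chi> i j. M (f i) (f j))"
proof -
  let ?g = "inv_into UNIV f"
  define T :: "bit ^ 'n \<Rightarrow> 'v \<Rightarrow> bit"
    where "T = (\<lambda>x v. if v \<in> V then x $ ?g v else 0)"
  interpret P: finite_dimensional_vector_space_pair_1
    "(*s) :: bit \<Rightarrow> bit ^ 'n \<Rightarrow> bit ^ 'n" cart_basis fun_scale ..
  have inj: "inj f" and V: "V = range f"
    using f by (auto simp: bij_betw_def)
  have lin: "Vector_Spaces.linear (*s) fun_scale T"
    by unfold_locales (auto simp: T_def fun_scale_def fun_eq_iff)
  have injT: "inj T"
  proof (rule injI)
    fix x y :: "bit ^ 'n"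
    assume "T x = T y"
    then have "T x (f i) = T y (f i)" for i by simp
    then show "x = y" by (simp add: T_def V inj vec_eq_iff)
  qed
  have rows: "row_on V M ` V = T ` rows (\<chi> i j. M (f i) (f j))"
  proof -
    have row: "row_on V M (f i) = T (row i (\<chi> i j. M (f i) (f j)))" for i
      by (auto simp: row_on_def T_def row_def V fun_eq_iff inj)
    have "row_on V M ` V = range (\<lambda>i. row_on V M (f i))"
      unfolding V by (rule image_image)
    also have "\<dots> = T ` range (\<lambda>i. row i (\<chi> i j. M (f i) (f j)))"
      unfolding row by (rule image_image[symmetric])
    finally show ?thesis by (simp add: rows_def full_SetCompr_eq)
  qed
  show ?thesis
    unfolding rank_on_def rows row_rank_def_gen
    by (rule P.dim_image_eq[OF lin inj_on_subset[OF injT subset_UNIV]])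
qed


section \<open>The modified partial Petrial polynomial\<close>

definition adj :: "'v signed_graph \<Rightarrow> 'v \<Rightarrow> 'v \<Rightarrow> bit" where
  "adj S u v = (if u = v then of_bool (u \<in> neg S) else of_bool ({u, v} \<in> edges S))"

definition diag_ind :: "'v set \<Rightarrow> 'v \<Rightarrow> 'v \<Rightarrow> bit" where
  "diag_ind W u v = of_bool (u = v \<and> u \<in> W)"

definition mod_partial_petrial :: "'v signed_graph \<Rightarrow> int poly" where
  "mod_partial_petrial S =
     (\<Sum>A\<in>Pow (verts S).
        monom ((-1) ^ card A)
          (rank_on (verts S) (\<lambda>u v. adj S u v + diag_ind (sym_diff (neg S) A) u v)))"


section \<open>The two operations and 4-invariants\<close>

text \<open>
  \<open>toggle_edge a b S\<close> is $S'_{a,b}$ and \<open>slide a b S\<close> is $\widetilde{S}_{a,b}$; they commute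
  (\<open>slide_toggle_edge_commute\<close>), so $\widetilde{S}'_{a,b}$ is \<open>toggle_edge a b (slide a b S)\<close>.
\<close>

definition toggle_edge :: "'v \<Rightarrow> 'v \<Rightarrow> 'v signed_graph \<Rightarrow> 'v signed_graph" where
  "toggle_edge a b S = S\<lparr>edges := sym_diff (edges S) {{a, b}}\<rparr>"

definition slide :: "'v \<Rightarrow> 'v \<Rightarrow> 'v signed_graph \<Rightarrow> 'v signed_graph" where
  "slide a b S =
     S\<lparr>edges := sym_diff (edges S) {{a, c} | c. c \<in> neighbours S b \<and> c \<noteq> a},
       neg := (if b \<in> neg S then sym_diff (neg S) {a} else neg S)\<rparr>"

lemma simple_toggle_edge:
  assumes "simple_signed_graph S" "a \<in> verts S" "b \<in> verts S" "a \<noteq> b"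
  shows "simple_signed_graph (toggle_edge a b S)"
  using assms by (auto simp: simple_signed_graph_def toggle_edge_def)

lemma simple_slide:
  assumes "simple_signed_graph S" "a \<in> verts S"
  shows "simple_signed_graph (slide a b S)"
proof -
  have "{a, c} \<subseteq> verts S \<and> card {a, c} = 2" if "c \<in> neighbours S b" "c \<noteq> a" for c
    using assms that unfolding simple_signed_graph_def neighbours_def by auto
  then show ?thesis
    using assms unfolding simple_signed_graph_def slide_def by auto
qed

lemma slide_toggle_edge_commute:
  assumes "a \<noteq> b"
  shows "slide a b (toggle_edge a b S) = toggle_edge a b (slide a b S)"
proof -
  have "c \<in> neighbours (toggle_edge a b S) b \<longleftrightarrow> c \<in> neighbours S b" if "c \<noteq> a" for c
    using that assms by (auto simp: neighbours_def toggle_edge_def doubleton_eq_iff)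
  then have "{{a, c} |c. c \<in> neighbours (toggle_edge a b S) b \<and> c \<noteq> a} =
             {{a, c} |c. c \<in> neighbours S b \<and> c \<noteq> a}"
    by metis
  moreover have "sym_diff (sym_diff E F) G = sym_diff (sym_diff E G) F" for E F G :: "'a set set"
    by blast
  moreover have "neg (toggle_edge a b S) = neg S" "edges (toggle_edge a b S) = sym_diff (edges S) {{a, b}}"
    by (simp_all add: toggle_edge_def)
  ultimately show ?thesis
    unfolding slide_def by (simp add: toggle_edge_def)
qed

definition graph_invariant :: "('v signed_graph \<Rightarrow> 'b) \<Rightarrow> bool" where
  "graph_invariant g \<longleftrightarrow>
     (\<forall>S T. simple_signed_graph S \<longrightarrow> simple_signed_graph T \<longrightarrow> signed_graph_iso S T \<longrightarrow> g S = g T)"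

definition four_invariant :: "('v signed_graph \<Rightarrow> 'b::ab_group_add) \<Rightarrow> bool" where
  "four_invariant g \<longleftrightarrow>
     graph_invariant g \<and>
     (\<forall>S. simple_signed_graph S \<longrightarrow>
        (\<forall>a\<in>verts S. \<forall>b\<in>verts S. a \<noteq> b \<longrightarrow>
           g S - g (slide a b S) + g (toggle_edge a b (slide a b S)) - g (toggle_edge a b S) = 0))"

end

theory Submission
  imports Defs
begin

text \<open>
  The diagonal of \<open>adj S\<close> is the indicator of the negative vertices, and it cancels against the
  \<open>neg S\<close> in the symmetric difference. Hence the polynomial is
  \[ P(S) = \sum_{A \subseteq V} (-1)^{|A|} z^{\operatorname{rank} M_A(S)}, \]
  where \<open>M\<^sub>A(S)\<close> has the adjacency of the underlying unsigned graph off the diagonal and the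
  indicator of \<open>A\<close> on it (\<open>framed_adj\<close>); signs of vertices have disappeared.

  The reason for the four-term relation is one congruence over \<open>GF(2)\<close>: adding row \<open>b\<close> to row
  \<open>a\<close> and then column \<open>b\<close> to column \<open>a\<close> preserves the rank. Applied to \<open>M\<^sub>A(S)\<close> it adds the
  neighbourhood of \<open>b\<close> to that of \<open>a\<close>, as sliding does; it adds the diagonal entry of \<open>b\<close> to
  the entry at \<open>{a, b}\<close>, and also to the diagonal entry of \<open>a\<close>. So if \<open>b \<notin> A\<close>, the result is
  \<open>M\<^sub>A\<close> of the slid graph, while if \<open>b \<in> A\<close>, the result belongs to the slid graph with the edge
  \<open>ab\<close> toggled, and \<open>A\<close> is replaced by \<open>A \<Delta> {a}\<close> (\<open>rank_framed_adj_slide\<close>).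

  Split \<open>P = P\<^sub>0 + P\<^sub>1\<close> according to whether \<open>b \<in> A\<close>. Passing from \<open>A\<close> to \<open>A \<Delta> {a}\<close> changes the
  parity of \<open>|A|\<close>, so the congruence says that sliding preserves \<open>P\<^sub>0\<close> and that sliding followed
  by toggling negates \<open>P\<^sub>1\<close>. Using both facts for \<open>S\<close> and for \<open>S\<close> with \<open>ab\<close> toggled, all terms
  of the alternating sum cancel.
\<close>

section \<open>Rank of matrices indexed by a finite set\<close>

lemma rank_on_cong:
  assumes "\<And>u v. u \<in> V \<Longrightarrow> v \<in> V \<Longrightarrow> M u v = N u v"
  shows "rank_on V M = rank_on V N"
proof -
  have "row_on V M ` V = row_on V N ` V"
    by (rule image_cong) (auto simp: row_on_def fun_eq_iff assms)
  then show ?thesis by (simp add: rank_on_def)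
qed

text \<open>
  A basis of the span of \<open>B\<close> is carried by \<open>T\<close> to a basis of the span of \<open>T ` B\<close>. The ambient
  function spaces may be infinite-dimensional, and \<open>T\<close> may fail to be injective outside the span.
\<close>

lemma gf2_dim_image_eq:
  fixes T :: "('v \<Rightarrow> bit) \<Rightarrow> 'w \<Rightarrow> bit"
  assumes lin: "Vector_Spaces.linear fun_scale fun_scale T"
    and inj: "inj_on T (gf2.span B)"
  shows "gf2.dim (T ` B) = gf2.dim B"
proof -
  interpret T: Vector_Spaces.linear fun_scale fun_scale T by (rule lin)
  obtain C where C: "C \<subseteq> B" "gf2.independent C" "B \<subseteq> gf2.span C" "card C = gf2.dim B"
    using gf2.basis_exists[of B] by blast
  have span: "gf2.span C = gf2.span B"
    using C by (simp add: gf2.span_eq gf2.span_superset subset_trans)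
  have injC: "inj_on T (gf2.span C)"
    using inj span by simp
  have "gf2.independent (T ` C)"
    using T.independent_inj_on_image[OF C(2) injC] .
  moreover have "gf2.span (T ` C) = gf2.span (T ` B)"
    by (simp add: T.span_image span)
  ultimately have "gf2.dim (T ` B) = card (T ` C)"
    using gf2.dim_eq_card by blast
  also have "\<dots> = card C"
    by (rule card_image) (rule inj_on_subset[OF injC gf2.span_superset])
  finally show ?thesis using C by simp
qed

lemma rank_on_reindex:
  assumes f: "bij_betw f V W"
    and eq: "\<And>u v. u \<in> V \<Longrightarrow> v \<in> V \<Longrightarrow> N (f u) (f v) = M u v"
  shows "rank_on W N = rank_on V M"
proof -
  define g where "g = inv_into V f"
  define T :: "('a \<Rightarrow> bit) \<Rightarrow> 'b \<Rightarrow> bit"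
    where "T = (\<lambda>x w. if w \<in> W then x (g w) else 0)"
  have g: "g (f v) = v" if "v \<in> V" for v
    using f that by (simp add: g_def bij_betw_inv_into_left)
  have fV: "f v \<in> W" if "v \<in> V" for v
    using f that by (auto simp: bij_betw_def)
  have gW: "g w \<in> V" "f (g w) = w" if "w \<in> W" for w
    using f that by (auto simp: g_def bij_betw_inv_into_right bij_betw_def inv_into_into)
  have lin: "Vector_Spaces.linear fun_scale fun_scale T"
    by unfold_locales (auto simp: T_def fun_scale_def fun_eq_iff)
  \<comment> \<open>\<open>T\<close> forgets the values outside \<open>V\<close>, hence is injective only on functions supported on \<open>V\<close>.\<close>
  have supp: "x v = 0" if "x \<in> gf2.span (row_on V M ` V)" "v \<notin> V" for x v
    using that(1)
    by (induction rule: gf2.span_induct_alt) (auto simp: row_on_def fun_scale_def that(2))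
  have inj: "inj_on T (gf2.span (row_on V M ` V))"
  proof (rule inj_onI, rule ext)
    fix x y v
    assume x: "x \<in> gf2.span (row_on V M ` V)" and y: "y \<in> gf2.span (row_on V M ` V)"
      and "T x = T y"
    then have "T x (f v) = T y (f v)" by simp
    then show "x v = y v"
      using supp[OF x] supp[OF y] by (cases "v \<in> V") (auto simp: T_def g fV)
  qed
  have row: "row_on W N (f u) = T (row_on V M u)" if "u \<in> V" for u
  proof
    fix w
    show "row_on W N (f u) w = T (row_on V M u) w"
      using eq[OF that, of "g w"] gW[of w] by (auto simp: row_on_def T_def)
  qed
  have "row_on W N ` W = row_on W N ` f ` V"
    using f by (simp add: bij_betw_def)
  also have "\<dots> = T ` row_on V M ` V"
    unfolding image_image by (rule image_cong) (simp_all add: row)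
  finally show ?thesis
    by (simp add: rank_on_def gf2_dim_image_eq[OF lin inj])
qed

lemma rank_on_add_row:
  assumes ab: "a \<in> V" "b \<in> V" "a \<noteq> b"
  shows "rank_on V (\<lambda>u v. M u v + (if u = a then M b v else 0)) = rank_on V M"
proof -
  let ?N = "\<lambda>u v. M u v + (if u = a then M b v else 0)"
  have other: "row_on V ?N u = row_on V M u" if "u \<noteq> a" for u
    using that by (simp add: row_on_def fun_eq_iff)
  have Na: "row_on V ?N a = row_on V M a + row_on V M b"
    by (auto simp: row_on_def)
  \<comment> \<open>In characteristic 2 the row operation is undone by repeating it.\<close>
  have Ma: "row_on V M a = row_on V ?N a + row_on V ?N b"
    using ab by (auto simp: row_on_def fun_eq_iff add.assoc)
  have base: "row_on V K u \<in> gf2.span (row_on V K ` V)" if "u \<in> V" for K u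
    using that by (auto intro: gf2.span_base)
  have "row_on V ?N u \<in> gf2.span (row_on V M ` V)" if "u \<in> V" for u
  proof (cases "u = a")
    case True
    show ?thesis unfolding True Na by (intro gf2.span_add base ab)
  next
    case False
    show ?thesis unfolding other[OF False] by (rule base[OF that])
  qed
  moreover have "row_on V M u \<in> gf2.span (row_on V ?N ` V)" if "u \<in> V" for u
  proof (cases "u = a")
    case True
    show ?thesis unfolding True Ma by (intro gf2.span_add base ab)
  next
    case False
    show ?thesis unfolding other[OF False, symmetric] by (rule base[OF that])
  qed
  ultimately have "gf2.span (row_on V ?N ` V) = gf2.span (row_on V M ` V)"
    unfolding gf2.span_eq by blast
  then show ?thesis
    unfolding rank_on_def by (rule gf2.span_eq_dim)
qed

lemma rank_on_add_column:
  assumes ab: "a \<in> V" "b \<in> V" "a \<noteq> b"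
  shows "rank_on V (\<lambda>u v. M u v + (if v = a then M u b else 0)) = rank_on V M"
proof -
  define T :: "('a \<Rightarrow> bit) \<Rightarrow> 'a \<Rightarrow> bit"
    where "T = (\<lambda>x v. x v + (if v = a then x b else 0))"
  have lin: "Vector_Spaces.linear fun_scale fun_scale T"
    by unfold_locales (auto simp: T_def fun_scale_def fun_eq_iff algebra_simps)
  \<comment> \<open>In characteristic 2 a transvection is its own inverse.\<close>
  have invol: "T (T x) = x" for x
    using ab by (auto simp: T_def fun_eq_iff add.assoc)
  have inj: "inj_on T (gf2.span (row_on V M ` V))"
    by (rule inj_on_inverseI[of _ T]) (rule invol)
  have "row_on V (\<lambda>u v. M u v + (if v = a then M u b else 0)) u = T (row_on V M u)" for u
    using ab by (auto simp: row_on_def T_def fun_eq_iff)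
  then have "row_on V (\<lambda>u v. M u v + (if v = a then M u b else 0)) ` V = T ` row_on V M ` V"
    by (simp add: image_image)
  then show ?thesis
    by (simp add: rank_on_def gf2_dim_image_eq[OF lin inj])
qed


section \<open>The polynomial in terms of the unsigned graph\<close>

definition framed_adj :: "'v signed_graph \<Rightarrow> 'v set \<Rightarrow> 'v \<Rightarrow> 'v \<Rightarrow> bit" where
  "framed_adj S A u v = (if u = v then of_bool (u \<in> A) else of_bool ({u, v} \<in> edges S))"

lemma adj_plus_diag_eq_framed_adj:
  "(\<lambda>u v. adj S u v + diag_ind (sym_diff (neg S) A) u v) = framed_adj S A"
  by (auto simp: fun_eq_iff adj_def diag_ind_def framed_adj_def)

definition petrial_term :: "'v signed_graph \<Rightarrow> 'v set \<Rightarrow> int poly" where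
  "petrial_term S A = monom ((-1) ^ card A) (rank_on (verts S) (framed_adj S A))"

lemma mod_partial_petrial_eq:
  "mod_partial_petrial S = (\<Sum>A\<in>Pow (verts S). petrial_term S A)"
  unfolding mod_partial_petrial_def petrial_term_def adj_plus_diag_eq_framed_adj ..

lemma graph_invariant_mod_partial_petrial:
  "graph_invariant (mod_partial_petrial :: 'v signed_graph \<Rightarrow> int poly)"
  unfolding graph_invariant_def
proof (intro allI impI)
  fix S T :: "'v signed_graph"
  assume "signed_graph_iso S T"
  then obtain f where f: "bij_betw f (verts S) (verts T)"
    and e: "\<And>u v. u \<in> verts S \<Longrightarrow> v \<in> verts S \<Longrightarrow> {u, v} \<in> edges S \<longleftrightarrow> {f u, f v} \<in> edges T"
    unfolding signed_graph_iso_def by blast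
  have inj: "inj_on f (verts S)"
    using f by (simp add: bij_betw_def)
  have "petrial_term T (f ` A) = petrial_term S A" if A: "A \<subseteq> verts S" for A
  proof -
    have "rank_on (verts T) (framed_adj T (f ` A)) = rank_on (verts S) (framed_adj S A)"
    proof (rule rank_on_reindex[OF f])
      fix u v assume uv: "u \<in> verts S" "v \<in> verts S"
      show "framed_adj T (f ` A) (f u) (f v) = framed_adj S A u v"
        by (simp only: framed_adj_def e[OF uv] inj_on_eq_iff[OF inj uv]
            inj_on_image_mem_iff[OF inj uv(1) A])
    qed
    then show ?thesis
      using inj_on_subset[OF inj A] by (simp add: petrial_term_def card_image)
  qed
  then show "mod_partial_petrial S = mod_partial_petrial T"
    unfolding mod_partial_petrial_eq
    using sum.reindex_bij_betw[OF bij_betw_Pow[OF f], of "petrial_term T"] by simp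
qed


section \<open>Sliding as a congruence\<close>

lemma toggle_edge_toggle_edge: "toggle_edge a b (toggle_edge a b S) = S"
proof -
  have "sym_diff (sym_diff E F) F = E" for E F :: "'a set set" by blast
  then show ?thesis by (simp add: toggle_edge_def)
qed

lemma verts_toggle_edge [simp]: "verts (toggle_edge a b S) = verts S"
  by (simp add: toggle_edge_def)

lemma verts_slide [simp]: "verts (slide a b S) = verts S"
  by (simp add: slide_def)

lemma edge_toggle_edge_iff:
  "{u, v} \<in> edges (toggle_edge a b S) \<longleftrightarrow> ({u, v} \<in> edges S) \<noteq> ({u, v} = {a, b})"
  by (auto simp: toggle_edge_def)

lemma edge_slide_iff:
  assumes "u \<noteq> v"
  shows "{u, v} \<in> edges (slide a b S) \<longleftrightarrow>
    ({u, v} \<in> edges S) \<noteq> (u = a \<and> {b, v} \<in> edges S \<or> v = a \<and> {b, u} \<in> edges S)"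
  using assms by (auto simp: slide_def neighbours_def doubleton_eq_iff)

text \<open>
  The two cases differ because the diagonal entry of \<open>b\<close>, which is the indicator of \<open>b \<in> A\<close>, is
  what the row and column operations add to the entries at \<open>(a, b)\<close>, \<open>(b, a)\<close> and \<open>(a, a)\<close>. The
  contributions of the entry at \<open>(a, b)\<close> to the one at \<open>(a, a)\<close> come twice, by symmetry, and cancel in \<open>GF(2)\<close>.
\<close>

lemma rank_framed_adj_slide:
  assumes S: "simple_signed_graph S" and ab: "a \<in> verts S" "b \<in> verts S" "a \<noteq> b"
  shows "b \<notin> A \<Longrightarrow>
      rank_on (verts S) (framed_adj (slide a b S) A) = rank_on (verts S) (framed_adj S A)"
    and "b \<in> A \<Longrightarrow>
      rank_on (verts S) (framed_adj (toggle_edge a b (slide a b S)) (sym_diff A {a}))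
        = rank_on (verts S) (framed_adj S A)"
proof -
  let ?M = "framed_adj S A"
  let ?R = "\<lambda>u v. ?M u v + (if u = a then ?M b v else 0)"
  let ?C = "\<lambda>u v. ?R u v + (if v = a then ?R u b else 0)"
  have rank: "rank_on (verts S) ?C = rank_on (verts S) ?M"
    using rank_on_add_column[OF ab, of ?R] rank_on_add_row[OF ab, of ?M] by (rule trans)
  have loop: "{u} \<notin> edges S" for u
    using S by (fastforce simp: simple_signed_graph_def)
  have eq0: "framed_adj (slide a b S) A u v = ?C u v" if "b \<notin> A" for u v
    using that ab loop
    by (cases "u = v"; cases "u = a"; cases "v = a"; cases "u = b"; cases "v = b")
      (auto simp: framed_adj_def edge_slide_iff insert_commute)
  have eq1: "framed_adj (toggle_edge a b (slide a b S)) (sym_diff A {a}) u v = ?C u v"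
    if "b \<in> A" for u v
    using that ab loop
    by (cases "u = v"; cases "u = a"; cases "v = a"; cases "u = b"; cases "v = b")
      (auto simp: framed_adj_def edge_slide_iff edge_toggle_edge_iff insert_commute doubleton_eq_iff)
  show "rank_on (verts S) (framed_adj (slide a b S) A) = rank_on (verts S) ?M" if "b \<notin> A"
    unfolding rank[symmetric] by (rule rank_on_cong) (rule eq0[OF that])
  show "rank_on (verts S) (framed_adj (toggle_edge a b (slide a b S)) (sym_diff A {a}))
      = rank_on (verts S) ?M" if "b \<in> A"
    unfolding rank[symmetric] by (rule rank_on_cong) (rule eq1[OF that])
qed


section \<open>The four-term relation\<close>

definition petrial_without :: "'v \<Rightarrow> 'v signed_graph \<Rightarrow> int poly" where
  "petrial_without b S = (\<Sum>A | A \<subseteq> verts S \<and> b \<notin> A. petrial_term S A)"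

definition petrial_with :: "'v \<Rightarrow> 'v signed_graph \<Rightarrow> int poly" where
  "petrial_with b S = (\<Sum>A | A \<subseteq> verts S \<and> b \<in> A. petrial_term S A)"

lemma mod_partial_petrial_split:
  assumes "simple_signed_graph S"
  shows "mod_partial_petrial S = petrial_without b S + petrial_with b S"
proof -
  have fin: "finite (Pow (verts S))"
    using assms by (simp add: simple_signed_graph_def)
  have "Pow (verts S) = {A. A \<subseteq> verts S \<and> b \<notin> A} \<union> {A. A \<subseteq> verts S \<and> b \<in> A}"
    by auto
  moreover have "finite {A. A \<subseteq> verts S \<and> b \<notin> A}" "finite {A. A \<subseteq> verts S \<and> b \<in> A}"
    by (auto intro: finite_subset[OF _ fin])
  ultimately show ?thesis
    unfolding mod_partial_petrial_eq petrial_without_def petrial_with_def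
    by (auto intro!: sum.union_disjoint)
qed

lemma petrial_without_slide:
  assumes "simple_signed_graph S" "a \<in> verts S" "b \<in> verts S" "a \<noteq> b"
  shows "petrial_without b (slide a b S) = petrial_without b S"
  unfolding petrial_without_def
  by (rule sum.cong) (auto simp: petrial_term_def rank_framed_adj_slide(1)[OF assms])

lemma minus_one_power_card_sym_diff_singleton:
  assumes "finite A"
  shows "(-1 :: 'a :: comm_ring_1) ^ card (sym_diff A {a}) = - ((-1) ^ card A)"
proof (cases "a \<in> A")
  case True
  then have "sym_diff A {a} = A - {a}" by blast
  then show ?thesis using card.remove[OF assms True] by simp
next
  case False
  then have "sym_diff A {a} = insert a A" by blast
  then show ?thesis using assms False by simp
qed

text \<open>The sign is the change of parity of \<open>|A|\<close> under the involution \<open>A \<mapsto> A \<Delta> {a}\<close>.\<close>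

lemma petrial_with_toggle_edge_slide:
  assumes S: "simple_signed_graph S" and ab: "a \<in> verts S" "b \<in> verts S" "a \<noteq> b"
  shows "petrial_with b (toggle_edge a b (slide a b S)) = - petrial_with b S"
proof -
  let ?T = "toggle_edge a b (slide a b S)"
  let ?F = "{A. A \<subseteq> verts S \<and> b \<in> A}"
  have invol: "sym_diff (sym_diff A {a}) {a} = A" for A by blast
  have bij: "bij_betw (\<lambda>A. sym_diff A {a}) ?F ?F"
    by (rule bij_betw_byWitness[where f' = "\<lambda>A. sym_diff A {a}"]) (use ab in auto)
  have "petrial_with b ?T = (\<Sum>A\<in>?F. petrial_term ?T (sym_diff A {a}))"
    unfolding petrial_with_def using sum.reindex_bij_betw[OF bij, of "petrial_term ?T"] by simp
  also have "\<dots> = (\<Sum>A\<in>?F. - petrial_term S A)"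
  proof (rule sum.cong)
    fix A assume A: "A \<in> ?F"
    then have "finite A"
      using S by (auto simp: simple_signed_graph_def intro: finite_subset)
    then show "petrial_term ?T (sym_diff A {a}) = - petrial_term S A"
      using A rank_framed_adj_slide(2)[OF S ab, of A]
      by (simp add: petrial_term_def minus_one_power_card_sym_diff_singleton minus_monom)
  qed simp
  finally show ?thesis
    by (simp add: petrial_with_def sum_negf)
qed

theorem theorem1p4:
  shows "four_invariant (mod_partial_petrial :: 'v signed_graph \<Rightarrow> int poly)"
  unfolding four_invariant_def
proof (intro conjI allI impI ballI)
  show "graph_invariant (mod_partial_petrial :: 'v signed_graph \<Rightarrow> int poly)"
    by (rule graph_invariant_mod_partial_petrial)
next
  fix S :: "'v signed_graph" and a b
  assume S: "simple_signed_graph S" and ab: "a \<in> verts S" "b \<in> verts S" "a \<noteq> b"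
  let ?S' = "toggle_edge a b S" and ?T = "slide a b S"
  let ?T' = "toggle_edge a b ?T"
  have S': "simple_signed_graph ?S'" and T: "simple_signed_graph ?T"
    using S ab by (simp_all add: simple_toggle_edge simple_slide)
  have T': "simple_signed_graph ?T'"
    using T ab by (simp add: simple_toggle_edge)
  have ab': "a \<in> verts ?S'" "b \<in> verts ?S'"
    using ab by simp_all
  have slide': "slide a b ?S' = ?T'"
    using ab by (simp add: slide_toggle_edge_commute)
  have "petrial_without b ?T = petrial_without b S"
    by (rule petrial_without_slide[OF S ab])
  moreover have "petrial_without b ?T' = petrial_without b ?S'"
    using petrial_without_slide[OF S' ab' ab(3)] by (simp add: slide')
  moreover have "petrial_with b ?T' = - petrial_with b S"
    by (rule petrial_with_toggle_edge_slide[OF S ab])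
  moreover have "petrial_with b ?T = - petrial_with b ?S'"
    using petrial_with_toggle_edge_slide[OF S' ab' ab(3)]
    by (simp add: slide' toggle_edge_toggle_edge)
  ultimately show "mod_partial_petrial S - mod_partial_petrial ?T
      + mod_partial_petrial ?T' - mod_partial_petrial ?S' = 0"
    by (simp add: mod_partial_petrial_split[of _ b] S S' T T')
qed

end
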